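(* Let $\beta>0$, let $X,Y$ be $\beta$-homogeneous $F$-spaces and let $\varphi: X^{2} \to [0,\infty)$ be a function satisfying $$\Psi(x,y):=\sum_{j=0}^{\infty}\frac{1}{2^{(j+1)\beta}}\,\varphi(2^{j}x,2^{j}y)<\infty$$ for all $x,y\in X$. Let $f:X^{2}\to Y$ be a mapping satisfying $f(x,0)=f(0,z)=0$ for all $x,z\in X$ and $$\|f(x+y,z+w)+f(x-y,z-w)-2f(x,z)-2f(x,w)\|\le \varphi(x,y)\,\varphi(z,w)$$ for all $x,y,z,w\in X$. Then there exists a unique additive-quadratic mapping $F:X^{2}\to Y$ such that $$\|f(x,z)-F(x,z)\|\le \min\{\Psi(x,x)\,\varphi(z,0),\ \varphi(x,0)\,\Phi(z,z)\}$$ for all $x,z\in X$, where $$\Phi(x,y):=\sum_{j=0}^{\infty}\frac{1}{4^{(j+1)\beta}}\,\varphi(2^{j}x,2^{j}y)$$ for all $x,y\in X$.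
   Context: An $F$-norm on a (complex) linear space $X$ is a function $\|\cdot\|:X\to[0,\infty)$ such that: (1) $\|x\|=0$ iff $x=0$; (2) $\|\lambda x\|=\|x\|$ whenever $|\lambda|=1$; (3) $\|x+y\|\le\|x\|+\|y\|$; (4) $\|\lambda_n x\|\to0$ whenever $\lambda_n\to0$; (5) $\|\lambda x_n\|\to0$ whenever $x_n\to0$; (6) $\|\lambda_n x_n\|\to0$ whenever $\lambda_n\to0$ and $x_n\to0$. An $F$-space is a linear space with an $F$-norm that is complete for the metric $\|x-y\|$. It is $\beta$-homogeneous ($\beta>0$) if $\|tx\|=|t|^{\beta}\|x\|$ for all $x\in X$ and all $t\in\mathbb{C}$. The same $\beta$ is used for $X$ and $Y$, and both $F$-norms are written $\|\cdot\|$. A mapping $F:X^2\to Y$ is called additive-quadratic if $F(x+y,z+w)+F(x-y,z-w)-2F(x,z)-2F(x,w)=0$ for all $x,y,z,w\in X$. *)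

theory Defs
  imports "HOL-Analysis.Analysis"
begin

locale F_norm = vector_space scale
  for scale :: "complex \<Rightarrow> 'a::ab_group_add \<Rightarrow> 'a"  (infixr "*s" 75) +
  fixes N :: "'a \<Rightarrow> real"
  assumes nonneg: "N x \<ge> 0"
    and eq_0_iff: "N x = 0 \<longleftrightarrow> x = 0"
    and rotate: "cmod a = 1 \<Longrightarrow> N (a *s x) = N x"
    and triangle_ineq: "N (x + y) \<le> N x + N y"
    and tendsto_scale_left: "c \<longlonglongrightarrow> 0 \<Longrightarrow> (\<lambda>n. N (c n *s x)) \<longlonglongrightarrow> 0"
    and tendsto_scale_right:
      "(\<lambda>n. N (s n)) \<longlonglongrightarrow> 0 \<Longrightarrow> (\<lambda>n. N (a *s s n)) \<longlonglongrightarrow> 0"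
    and tendsto_scale:
      "c \<longlonglongrightarrow> 0 \<Longrightarrow> (\<lambda>n. N (s n)) \<longlonglongrightarrow> 0 \<Longrightarrow> (\<lambda>n. N (c n *s s n)) \<longlonglongrightarrow> 0"
begin

sublocale metric: Metric_space UNIV "\<lambda>x y. N (x - y)"
proof
  show "0 \<le> N (x - y)" for x y
    by (rule nonneg)
  show "N (x - y) = N (y - x)" for x y
    using rotate[of "- 1" "y - x"] by simp
  show "N (x - y) = 0 \<longleftrightarrow> x = y" for x y
    by (simp add: eq_0_iff)
  show "N (x - z) \<le> N (x - y) + N (y - z)" for x y z
    using triangle_ineq[of "x - y" "y - z"] by simp
qed

end

locale F_space = F_norm +
  assumes complete: "metric.mcomplete"

locale homogeneous_F_space = F_space +
  fixes \<beta> :: real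
  assumes degree_pos: "\<beta> > 0"
    and homogeneous: "N (t *s x) = cmod t powr \<beta> * N x"

text \<open>Maps on \<open>X \<times> X\<close> are curried; the first argument \<open>scaleY\<close> is the scalar
  multiplication of the codomain.\<close>

definition additive_quadratic ::
    "(complex \<Rightarrow> 'b \<Rightarrow> 'b) \<Rightarrow> ('a::ab_group_add \<Rightarrow> 'a \<Rightarrow> 'b::ab_group_add) \<Rightarrow> bool" where
  "additive_quadratic scaleY F \<longleftrightarrow>
    (\<forall>x y z w. F (x + y) (z + w) + F (x - y) (z - w)
      - scaleY 2 (F x z) - scaleY 2 (F x w) = 0)"

end

theory Submission
  imports Defs
begin

text \<open>Putting \<open>w = 0\<close>, \<open>y = x\<close> in the hypothesis shows that \<open>f\<close> approximately doubles when
  its first argument doubles; putting \<open>y = 0\<close>, \<open>w = z\<close> shows that it approximately quadruples when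
  its second argument doubles. Hyers' direct method then gives two limits,
  \<open>F x z = lim 2\<^sup>-\<^sup>n f (2\<^sup>n x) z\<close> and \<open>G x z = lim 4\<^sup>-\<^sup>n f x (2\<^sup>n z)\<close>, each satisfying one half of the
  estimate. Both double exactly in the first argument, and the two estimates at \<open>(2\<^sup>n x, z)\<close>,
  divided by \<open>2\<^sup>n\<^sup>\<beta>\<close>, tend to zero; hence \<open>F = G\<close>. Uniqueness follows by the same scaling.\<close>

lemma suminf_tail_LIMSEQ_zero:
  fixes b :: "nat \<Rightarrow> real"
  assumes "summable b"
  shows "(\<lambda>n. \<Sum>i. b (i + n)) \<longlonglongrightarrow> 0"
  using suminf_exist_split[OF _ assms] by (simp add: LIMSEQ_iff)

section \<open>Limits with respect to an F-norm\<close>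

context F_norm
begin

lemma N_0 [simp]: "N 0 = 0"
  by (simp add: eq_0_iff)

lemma N_minus: "N (- x) = N x"
  using rotate[of "- 1" x] by simp

lemma N_diff_commute: "N (x - y) = N (y - x)"
  by (rule metric.commute)

lemma N_diff_le: "N (x - y) \<le> N x + N y"
  using triangle_ineq[of x "- y"] by (simp add: N_minus)

lemma eq_0_if_tendsto:
  assumes le: "\<And>n. N x \<le> e n" and "e \<longlonglongrightarrow> 0"
  shows "x = 0"
proof -
  have "N x \<le> 0"
    using LIMSEQ_le_const[OF \<open>e \<longlonglongrightarrow> 0\<close>] le by blast
  then show ?thesis
    using nonneg[of x] eq_0_iff[of x] by linarith
qed

lemma tendsto_unique:
  assumes "(\<lambda>n. N (s n - L)) \<longlonglongrightarrow> 0" "(\<lambda>n. N (s n - M)) \<longlonglongrightarrow> 0"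
  shows "L = M"
proof -
  have "L - M = 0"
  proof (rule eq_0_if_tendsto)
    show "N (L - M) \<le> N (s n - L) + N (s n - M)" for n
      using N_diff_le[of "s n - M" "s n - L"] by simp
    show "(\<lambda>n. N (s n - L) + N (s n - M)) \<longlonglongrightarrow> 0"
      using tendsto_add[OF assms] by simp
  qed
  then show ?thesis by simp
qed

lemma tendsto_addI:
  assumes "(\<lambda>n. N (s n - L)) \<longlonglongrightarrow> 0" "(\<lambda>n. N (t n - M)) \<longlonglongrightarrow> 0"
  shows "(\<lambda>n. N (s n + t n - (L + M))) \<longlonglongrightarrow> 0"
proof (rule Lim_null_comparison[OF always_eventually])
  show "\<forall>n. norm (N (s n + t n - (L + M))) \<le> N (s n - L) + N (t n - M)"
  proof
    fix n
    have "s n + t n - (L + M) = (s n - L) + (t n - M)" by simp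
    then show "norm (N (s n + t n - (L + M))) \<le> N (s n - L) + N (t n - M)"
      using triangle_ineq[of "s n - L" "t n - M"] nonneg[of "s n + t n - (L + M)"]
      by (metis abs_of_nonneg real_norm_def)
  qed
  show "(\<lambda>n. N (s n - L) + N (t n - M)) \<longlonglongrightarrow> 0"
    using tendsto_add[OF assms] by simp
qed

lemma tendsto_scaleI:
  assumes "(\<lambda>n. N (s n - L)) \<longlonglongrightarrow> 0"
  shows "(\<lambda>n. N (a *s s n - a *s L)) \<longlonglongrightarrow> 0"
  using tendsto_scale_right[OF assms, of a] by (simp add: scale_right_diff_distrib)

lemma tendsto_diffI:
  assumes "(\<lambda>n. N (s n - L)) \<longlonglongrightarrow> 0" "(\<lambda>n. N (t n - M)) \<longlonglongrightarrow> 0"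
  shows "(\<lambda>n. N (s n - t n - (L - M))) \<longlonglongrightarrow> 0"
  using tendsto_addI[OF assms(1) tendsto_scaleI[OF assms(2), of "- 1"]] by simp

end

text \<open>Telescoping bounds \<open>N (s n - s m)\<close> by a block of the series
  \<open>b\<close>, so \<open>s\<close> is Cauchy and completeness supplies the limit. The blocks
  starting at 0 stay below \<open>suminf b\<close>, which gives the distance from \<open>s 0\<close>
  to the limit.\<close>

lemma (in F_space) summable_increments_convergent:
  assumes inc: "\<And>n. N (s (Suc n) - s n) \<le> b n" and b: "summable b"
  shows "\<exists>L. (\<lambda>n. N (s n - L)) \<longlonglongrightarrow> 0 \<and> N (s 0 - L) \<le> suminf b"
proof -
  have b0: "0 \<le> b n" for n
    using inc[of n] nonneg[of "s (Suc n) - s n"] by linarith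
  have sum_bound: "N (s (m + k) - s m) \<le> sum b {m..<m + k}" for m k
  proof (induction k)
    case 0
    show ?case by simp
  next
    case (Suc k)
    have "s (m + Suc k) - s m = (s (Suc (m + k)) - s (m + k)) + (s (m + k) - s m)" by simp
    then have "N (s (m + Suc k) - s m) \<le> N (s (Suc (m + k)) - s (m + k)) + N (s (m + k) - s m)"
      by (metis triangle_ineq)
    also have "\<dots> \<le> b (m + k) + sum b {m..<m + k}"
      by (intro add_mono inc Suc)
    finally show ?case by simp
  qed
  have "metric.MCauchy s"
    unfolding metric.MCauchy_def
  proof (intro conjI allI impI)
    fix e :: real
    assume "0 < e"
    then obtain M where M: "\<And>m n. M \<le> m \<Longrightarrow> norm (sum b {m..<n}) < e"
      using b unfolding summable_Cauchy by meson
    have ordered: "N (s n - s m) < e" if "M \<le> m" "m \<le> n" for m n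
      using sum_bound[of m "n - m"] M[OF that(1), of n] that by simp
    have "N (s n - s m) < e" if "M \<le> m" "M \<le> n" for m n
      using ordered[of m n] ordered[of n m] that N_diff_commute[of "s n" "s m"]
      by (cases "m \<le> n") auto
    then show "\<exists>M. \<forall>n n'. M \<le> n \<longrightarrow> M \<le> n' \<longrightarrow> N (s n - s n') < e" by blast
  qed simp
  then obtain L where "limitin metric.mtopology s L sequentially"
    using complete unfolding metric.mcomplete_def by blast
  then have L: "(\<lambda>n. N (s n - L)) \<longlonglongrightarrow> 0"
    by (simp add: metric.limitin_metric_dist_null)
  have "N (s 0 - L) \<le> suminf b + N (s n - L)" for n
  proof -
    have "N (s 0 - L) \<le> N (s n - L) + N (s n - s 0)"
      using N_diff_le[of "s n - L" "s n - s 0"] by simp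
    moreover have "sum b {0..<n} \<le> suminf b"
      by (rule sum_le_suminf[OF b]) (use b0 in auto)
    ultimately show ?thesis using sum_bound[of 0 n] by simp
  qed
  moreover have "(\<lambda>n. suminf b + N (s n - L)) \<longlonglongrightarrow> suminf b"
    using tendsto_add[OF tendsto_const[of "suminf b"] L] by simp
  ultimately have "N (s 0 - L) \<le> suminf b"
    by (intro LIMSEQ_le_const[of "\<lambda>n. suminf b + N (s n - L)"]) auto
  with L show ?thesis by blast
qed

section \<open>Scaling arguments in homogeneous F-spaces\<close>

context homogeneous_F_space
begin

lemma N_power:
  assumes "0 < c"
  shows "N (complex_of_real c ^ n *s x) = c powr (real n * \<beta>) * N x"
  using assms
  by (simp add: homogeneous norm_power powr_powr flip: powr_realpow)

lemma N_inverse_power: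
  assumes "0 < c"
  shows "N (inverse (complex_of_real c ^ n) *s x) = 1 / c powr (real n * \<beta>) * N x"
  using assms N_power[OF assms, of n "inverse (complex_of_real c ^ n) *s x"]
  by (simp add: field_simps)

text \<open>Consecutive terms of the rescaled sequence differ by the defect
  \<open>g (Suc n) - c *s g n\<close> divided by \<open>c ^ (n + 1)\<close>. Homogeneity turns this
  factor into the weight \<open>1 / c powr (real (n + 1) * \<beta>)\<close>, which explains the
  shifted exponent in the series.\<close>

lemma direct_method:
  assumes c: "0 < c"
    and le: "\<And>n. N (g (Suc n) - complex_of_real c *s g n) \<le> e n"
    and sum: "summable (\<lambda>j. 1 / c powr (real (j + 1) * \<beta>) * e j)"
  shows "\<exists>L. (\<lambda>n. N (inverse (complex_of_real c ^ n) *s g n - L)) \<longlonglongrightarrow> 0 \<and>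
    N (g 0 - L) \<le> (\<Sum>j. 1 / c powr (real (j + 1) * \<beta>) * e j)"
proof -
  have "N (inverse (complex_of_real c ^ Suc n) *s g (Suc n) - inverse (complex_of_real c ^ n) *s g n)
      \<le> 1 / c powr (real (n + 1) * \<beta>) * e n" for n
  proof -
    have "inverse (complex_of_real c ^ Suc n) *s g (Suc n) - inverse (complex_of_real c ^ n) *s g n
      = inverse (complex_of_real c ^ Suc n) *s (g (Suc n) - complex_of_real c *s g n)"
      using c by (simp add: scale_right_diff_distrib field_simps)
    then have "N (inverse (complex_of_real c ^ Suc n) *s g (Suc n) - inverse (complex_of_real c ^ n) *s g n)
      = 1 / c powr (real (n + 1) * \<beta>) * N (g (Suc n) - complex_of_real c *s g n)"
      using N_inverse_power[OF c, of "Suc n"] by simp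
    also have "\<dots> \<le> 1 / c powr (real (n + 1) * \<beta>) * e n"
      by (intro mult_left_mono le) simp
    finally show ?thesis .
  qed
  from summable_increments_convergent[of "\<lambda>n. inverse (complex_of_real c ^ n) *s g n", OF this sum]
  show ?thesis by simp
qed

text \<open>By homogeneity \<open>N (c ^ n *s x)\<close> is exactly
  \<open>c powr (real n * \<beta>) * N x\<close>, so a bound of smaller order forces
  \<open>N x = 0\<close>. It serves to compare maps that obey the same exact scaling law.\<close>

lemma eq_0_by_scaling:
  assumes c: "0 < c"
    and le: "\<And>n. N (complex_of_real c ^ n *s x) \<le> e n"
    and lim: "(\<lambda>n. 1 / c powr (real n * \<beta>) * e n) \<longlonglongrightarrow> 0"
  shows "x = 0"
proof (rule eq_0_if_tendsto[OF _ lim])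
  fix n
  show "N x \<le> 1 / c powr (real n * \<beta>) * e n"
    using le[of n] c unfolding N_power[OF c] by (simp add: field_simps)
qed

text \<open>This turns approximate equations into exact ones: \<open>g n\<close> will be the defect
  of \<open>f\<close> at dilated points, and \<open>L\<close> the corresponding defect of the limit
  map.\<close>

lemma limit_eq_0:
  assumes c: "0 < c"
    and conv: "(\<lambda>n. N (inverse (complex_of_real c ^ n) *s g n - L)) \<longlonglongrightarrow> 0"
    and le: "\<And>n. N (g n) \<le> e n"
    and lim: "(\<lambda>n. 1 / c powr (real n * \<beta>) * e n) \<longlonglongrightarrow> 0"
  shows "L = 0"
proof (rule tendsto_unique[OF conv])
  show "(\<lambda>n. N (inverse (complex_of_real c ^ n) *s g n - 0)) \<longlonglongrightarrow> 0"
  proof (rule Lim_null_comparison[OF always_eventually lim], rule allI)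
    fix n
    have "1 / c powr (real n * \<beta>) * N (g n) \<le> 1 / c powr (real n * \<beta>) * e n"
      by (intro mult_left_mono le) simp
    then show "norm (N (inverse (complex_of_real c ^ n) *s g n - 0)) \<le> 1 / c powr (real n * \<beta>) * e n"
      using N_inverse_power[OF c, of n "g n"] nonneg by simp
  qed
qed

end

theorem theorem4:
  fixes scaleX :: "complex \<Rightarrow> 'a::ab_group_add \<Rightarrow> 'a"
    and scaleY :: "complex \<Rightarrow> 'b::ab_group_add \<Rightarrow> 'b"
    and normX :: "'a \<Rightarrow> real" and normY :: "'b \<Rightarrow> real"
    and \<beta> :: real
    and \<phi> \<Psi> \<Phi> :: "'a \<Rightarrow> 'a \<Rightarrow> real"
    and f :: "'a \<Rightarrow> 'a \<Rightarrow> 'b"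
  assumes "\<beta> > 0"
    and X: "homogeneous_F_space scaleX normX \<beta>"
    and Y: "homogeneous_F_space scaleY normY \<beta>"
    and phi_nonneg: "\<And>x y. \<phi> x y \<ge> 0"
    and Psi_summable:
      "\<And>x y. summable (\<lambda>j::nat. 1 / 2 powr (real (j + 1) * \<beta>) * \<phi> (scaleX (2 ^ j) x) (scaleX (2 ^ j) y))"
    and Psi:
      "\<And>x y. \<Psi> x y = (\<Sum>j::nat. 1 / 2 powr (real (j + 1) * \<beta>) * \<phi> (scaleX (2 ^ j) x) (scaleX (2 ^ j) y))"
    and Phi:
      "\<And>x y. \<Phi> x y = (\<Sum>j::nat. 1 / 4 powr (real (j + 1) * \<beta>) * \<phi> (scaleX (2 ^ j) x) (scaleX (2 ^ j) y))"
    and f_0_right: "\<And>x. f x 0 = 0"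
    and f_0_left: "\<And>z. f 0 z = 0"
    and f_bound: "\<And>x y z w.
      normY (f (x + y) (z + w) + f (x - y) (z - w) - scaleY 2 (f x z) - scaleY 2 (f x w))
        \<le> \<phi> x y * \<phi> z w"
  shows "\<exists>!F. additive_quadratic scaleY F \<and>
    (\<forall>x z. normY (f x z - F x z) \<le> min (\<Psi> x x * \<phi> z 0) (\<phi> x 0 * \<Phi> z z))"
proof -
  interpret X: homogeneous_F_space scaleX normX \<beta> by (rule X)
  interpret Y: homogeneous_F_space scaleY normY \<beta> by (rule Y)
  define \<psi> where "\<psi> x y j = \<phi> (scaleX (2 ^ j) x) (scaleX (2 ^ j) y)" for x y and j :: nat
  define D where "D h x y z w =
    h (x + y) (z + w) + h (x - y) (z - w) - scaleY 2 (h x z) - scaleY 2 (h x w)"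
    for h and x y z w :: 'a
  have \<psi>0: "0 \<le> \<psi> x y j" for x y j
    by (simp add: \<psi>_def phi_nonneg)
  have X_double: "scaleX 2 x = x + x" for x
    using X.scale_left_distrib[of 1 1 x] by simp
  have Y_double: "scaleY 2 x = x + x" for x
    using Y.scale_left_distrib[of 1 1 x] by simp
  have Y_four: "scaleY 4 x = scaleY 2 x + scaleY 2 x" for x
    using Y.scale_left_distrib[of 2 2 x] by simp
  have X_Suc: "scaleX (2 ^ Suc n) x = scaleX (2 ^ n) x + scaleX (2 ^ n) x" for n x
    by (simp flip: X_double)

  \<comment> \<open>Decay of the rescaled control functions\<close>
  have sum2: "summable (\<lambda>j. 1 / 2 powr (real (j + 1) * \<beta>) * \<psi> x y j)" for x y
    unfolding \<psi>_def by (rule Psi_summable)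
  \<comment> \<open>The terms of a convergent series vanish; the factor
    \<open>2 powr \<beta>\<close> lowers the exponent from \<open>n + 1\<close> to
    \<open>n\<close>.\<close>
  have \<psi>_lim2: "(\<lambda>n. 1 / 2 powr (real n * \<beta>) * \<psi> x y n) \<longlonglongrightarrow> 0" for x y
    using tendsto_mult_right_zero[OF summable_LIMSEQ_zero[OF sum2[of x y]], of "2 powr \<beta>"]
    by (simp add: distrib_right powr_add)
  \<comment> \<open>Since \<beta> is positive, the weights with base 4 are dominated by those with
    base 2. Hence the series of \<open>\<Phi>\<close> converges too.\<close>
  have four: "1 / (4::real) powr (real n * \<beta>) \<le> 1 / 2 powr (real n * \<beta>)" for n
    using \<open>\<beta> > 0\<close> by (intro divide_left_mono powr_mono2) auto
  have \<psi>_le: "norm (1 / 4 powr (real n * \<beta>) * \<psi> x y m) \<le> 1 / 2 powr (real n * \<beta>) * \<psi> x y m"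
    for x y n m
    using mult_right_mono[OF four[of n] \<psi>0[of x y m]] \<psi>0[of x y m] by simp
  have sum4: "summable (\<lambda>j. 1 / 4 powr (real (j + 1) * \<beta>) * \<psi> x y j)" for x y
    by (rule summable_comparison_test'[OF sum2[of x y], of 0]) (rule \<psi>_le)
  have \<psi>_lim4: "(\<lambda>n. 1 / 4 powr (real n * \<beta>) * \<psi> x y n) \<longlonglongrightarrow> 0" for x y
    by (rule Lim_null_comparison[OF always_eventually[OF allI] \<psi>_lim2[of x y]]) (rule \<psi>_le)
  have \<Psi>_lim: "(\<lambda>n. 1 / 2 powr (real n * \<beta>) * \<Psi> (scaleX (2 ^ n) x) (scaleX (2 ^ n) y)) \<longlonglongrightarrow> 0" for x y
  proof -
    \<comment> \<open>Dilating both arguments by \<open>2 ^ n\<close> shifts the index of the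
      series, so the rescaled value is the tail from \<open>n\<close> on of the series for
      \<open>\<Psi> x y\<close>.\<close>
    have "1 / 2 powr (real n * \<beta>) * \<Psi> (scaleX (2 ^ n) x) (scaleX (2 ^ n) y)
        = (\<Sum>i. 1 / 2 powr (real (i + n + 1) * \<beta>) * \<psi> x y (i + n))" for n
    proof -
      have "1 / 2 powr (real n * \<beta>) * (1 / 2 powr (real (i + 1) * \<beta>) *
          \<phi> (scaleX (2 ^ i) (scaleX (2 ^ n) x)) (scaleX (2 ^ i) (scaleX (2 ^ n) y)))
        = 1 / 2 powr (real (i + n + 1) * \<beta>) * \<psi> x y (i + n)" for i
        by (simp add: \<psi>_def distrib_right powr_add power_add)
      then show ?thesis
        unfolding Psi by (subst suminf_mult[OF Psi_summable, symmetric]) simp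
    qed
    then show ?thesis
      using suminf_tail_LIMSEQ_zero[OF sum2[of x y]] by simp
  qed

  have f_double: "normY (f (x + x) z - scaleY 2 (f x z)) \<le> \<phi> x x * \<phi> z 0" for x z
    using f_bound[of x x z 0] by (simp add: f_0_right f_0_left)
  have f_quad: "normY (f x (z + z) - scaleY 4 (f x z)) \<le> \<phi> x 0 * \<phi> z z" for x z
    using f_bound[of x 0 z z] by (simp add: f_0_right Y_four diff_diff_eq)

  \<comment> \<open>The limit in the first argument\<close>
  have "\<exists>L. (\<lambda>n. normY (scaleY (inverse (2 ^ n)) (f (scaleX (2 ^ n) x) z) - L)) \<longlonglongrightarrow> 0 \<and>
      normY (f x z - L) \<le> \<Psi> x x * \<phi> z 0" for x z
  proof -
    have "normY (f (scaleX (2 ^ Suc n) x) z - scaleY 2 (f (scaleX (2 ^ n) x) z)) \<le> \<psi> x x n * \<phi> z 0" for n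
      unfolding X_Suc \<psi>_def by (rule f_double)
    moreover have "summable (\<lambda>j. 1 / 2 powr (real (j + 1) * \<beta>) * (\<psi> x x j * \<phi> z 0))"
      using summable_mult2[OF sum2[of x x], of "\<phi> z 0"] by (simp only: mult.assoc)
    moreover have "(\<Sum>j. 1 / 2 powr (real (j + 1) * \<beta>) * (\<psi> x x j * \<phi> z 0)) = \<Psi> x x * \<phi> z 0"
      using suminf_mult2[OF sum2[of x x], of "\<phi> z 0"] unfolding Psi \<psi>_def by (simp only: mult.assoc)
    ultimately show ?thesis
      using Y.direct_method[of 2 "\<lambda>n. f (scaleX (2 ^ n) x) z" "\<lambda>n. \<psi> x x n * \<phi> z 0"] by simp
  qed
  then have "\<exists>F. \<forall>x z. (\<lambda>n. normY (scaleY (inverse (2 ^ n)) (f (scaleX (2 ^ n) x) z) - F x z)) \<longlonglongrightarrow> 0 \<and>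
      normY (f x z - F x z) \<le> \<Psi> x x * \<phi> z 0"
    by (intro choice allI)
  then obtain F where F_lim: "\<And>x z. (\<lambda>n. normY (scaleY (inverse (2 ^ n)) (f (scaleX (2 ^ n) x) z) - F x z)) \<longlonglongrightarrow> 0"
    and F_bound: "\<And>x z. normY (f x z - F x z) \<le> \<Psi> x x * \<phi> z 0"
    by blast

  \<comment> \<open>The limit in the second argument\<close>
  have "\<exists>L. (\<lambda>n. normY (scaleY (inverse (4 ^ n)) (f x (scaleX (2 ^ n) z)) - L)) \<longlonglongrightarrow> 0 \<and>
      normY (f x z - L) \<le> \<phi> x 0 * \<Phi> z z" for x z
  proof -
    have "normY (f x (scaleX (2 ^ Suc n) z) - scaleY 4 (f x (scaleX (2 ^ n) z))) \<le> \<phi> x 0 * \<psi> z z n" for n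
      unfolding X_Suc \<psi>_def by (rule f_quad)
    moreover have "summable (\<lambda>j. 1 / 4 powr (real (j + 1) * \<beta>) * (\<phi> x 0 * \<psi> z z j))"
      using summable_mult[OF sum4[of z z], of "\<phi> x 0"] by (simp only: mult.left_commute)
    moreover have "(\<Sum>j. 1 / 4 powr (real (j + 1) * \<beta>) * (\<phi> x 0 * \<psi> z z j)) = \<phi> x 0 * \<Phi> z z"
      using suminf_mult[OF sum4[of z z], of "\<phi> x 0"] unfolding Phi \<psi>_def by (simp only: mult.left_commute)
    ultimately show ?thesis
      using Y.direct_method[of 4 "\<lambda>n. f x (scaleX (2 ^ n) z)" "\<lambda>n. \<phi> x 0 * \<psi> z z n"] by simp
  qed
  then have "\<exists>G. \<forall>x z. (\<lambda>n. normY (scaleY (inverse (4 ^ n)) (f x (scaleX (2 ^ n) z)) - G x z)) \<longlonglongrightarrow> 0 \<and>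
      normY (f x z - G x z) \<le> \<phi> x 0 * \<Phi> z z"
    by (intro choice allI)
  then obtain G where G_lim: "\<And>x z. (\<lambda>n. normY (scaleY (inverse (4 ^ n)) (f x (scaleX (2 ^ n) z)) - G x z)) \<longlonglongrightarrow> 0"
    and G_bound: "\<And>x z. normY (f x z - G x z) \<le> \<phi> x 0 * \<Phi> z z"
    by blast

  \<comment> \<open>Only \<open>x\<close> and \<open>y\<close> are dilated. Dilation commutes with
    \<open>x + y\<close> and \<open>x - y\<close>, so the rescaled defects of \<open>f\<close>
    converge to that of \<open>F\<close>, while the factor \<open>\<phi> z w\<close> of their bound
    stays fixed.\<close>
  have D_F: "D F x y z w = 0" for x y z w
  proof (rule Y.limit_eq_0[where c = 2])
    show "normY (D f (scaleX (2 ^ n) x) (scaleX (2 ^ n) y) z w) \<le> \<psi> x y n * \<phi> z w" for n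
      unfolding D_def \<psi>_def by (rule f_bound)
    show "(\<lambda>n. 1 / 2 powr (real n * \<beta>) * (\<psi> x y n * \<phi> z w)) \<longlonglongrightarrow> 0"
      using tendsto_mult_left_zero[OF \<psi>_lim2[of x y], of "\<phi> z w"] by (simp only: mult.assoc)
    show "(\<lambda>n. normY (scaleY (inverse (complex_of_real 2 ^ n))
        (D f (scaleX (2 ^ n) x) (scaleX (2 ^ n) y) z w) - D F x y z w)) \<longlonglongrightarrow> 0"
      using Y.tendsto_diffI[OF Y.tendsto_diffI[OF Y.tendsto_addI[OF F_lim[of "x + y" "z + w"] F_lim[of "x - y" "z - w"]]
          Y.tendsto_scaleI[OF F_lim[of x z], of 2]] Y.tendsto_scaleI[OF F_lim[of x w], of 2]]
      by (simp add: D_def X.scale_right_distrib X.scale_right_diff_distrib Y.scale_right_distrib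
          Y.scale_right_diff_distrib mult.commute)
  qed simp
  then have F_aq: "additive_quadratic scaleY F"
    by (simp add: additive_quadratic_def D_def)

  have F_0_left: "F 0 z = 0" for z
    using F_lim[of 0 z] by (simp add: f_0_left LIMSEQ_const_iff Y.N_minus Y.eq_0_iff)

  \<comment> \<open>Scaling laws and the equality of the two limits\<close>
  have aq_0_right: "H x 0 = 0" if "additive_quadratic scaleY H" for H x
    using that[unfolded additive_quadratic_def, rule_format, of x 0 0 0]
    by (simp flip: Y_double)
  \<comment> \<open>With \<open>y = x\<close> and \<open>w = 0\<close> the equation retains the term
    \<open>H 0 z\<close>, hence the extra premise.\<close>
  have aq_double: "H (x + x) z = scaleY 2 (H x z)"
    if "additive_quadratic scaleY H" "\<And>z. H 0 z = 0" for H x z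
    using that(1)[unfolded additive_quadratic_def, rule_format, of x x z 0]
      aq_0_right[OF that(1), of x] that(2)[of z] by simp
  have aq_quad_left_0: "H 0 (z + z) = scaleY 4 (H 0 z)" if "additive_quadratic scaleY H" for H z
    using that[unfolded additive_quadratic_def, rule_format, of 0 0 z z]
      aq_0_right[OF that, of 0] by (simp add: Y_four diff_diff_eq)
  have double_power: "H (scaleX (2 ^ n) x) z = scaleY (2 ^ n) (H x z)"
    if "\<And>x z. H (x + x) z = scaleY 2 (H x z)" for H x z n
    by (induction n) (simp_all add: that X_Suc del: power_Suc, simp)

  \<comment> \<open>Here \<open>z\<close> is dilated while \<open>x\<close> is fixed: the doubling
    defect of \<open>f\<close> at \<open>2 ^ n\<close> times \<open>z\<close> is at most
    \<open>\<phi> x x * \<psi> z 0 n\<close>, which vanishes after division by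
    \<open>4 powr (real n * \<beta>)\<close>.\<close>
  have G_double: "G (x + x) z = scaleY 2 (G x z)" for x z
  proof -
    have "G (x + x) z - scaleY 2 (G x z) = 0"
    proof (rule Y.limit_eq_0[where c = 4])
      show "normY (f (x + x) (scaleX (2 ^ n) z) - scaleY 2 (f x (scaleX (2 ^ n) z))) \<le> \<phi> x x * \<psi> z 0 n" for n
        using f_double[of x "scaleX (2 ^ n) z"] by (simp add: \<psi>_def)
      show "(\<lambda>n. 1 / 4 powr (real n * \<beta>) * (\<phi> x x * \<psi> z 0 n)) \<longlonglongrightarrow> 0"
        using tendsto_mult_right_zero[OF \<psi>_lim4[of z 0], of "\<phi> x x"] by (simp only: mult.left_commute)
      show "(\<lambda>n. normY (scaleY (inverse (complex_of_real 4 ^ n))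
          (f (x + x) (scaleX (2 ^ n) z) - scaleY 2 (f x (scaleX (2 ^ n) z)))
          - (G (x + x) z - scaleY 2 (G x z)))) \<longlonglongrightarrow> 0"
        using Y.tendsto_diffI[OF G_lim[of "x + x" z] Y.tendsto_scaleI[OF G_lim[of x z], of 2]]
        by (simp add: Y.scale_right_diff_distrib mult.commute)
    qed simp
    then show ?thesis by simp
  qed

  \<comment> \<open>With \<open>z\<close> fixed, \<open>H\<close> and \<open>F\<close> both double
    exactly in \<open>x\<close>, while at \<open>2 ^ n\<close> times \<open>x\<close> each is close
    to \<open>f\<close> up to an error of order below \<open>2 powr (real n * \<beta>)\<close>. The
    error \<open>e\<close> is left general so that this applies both to \<open>G\<close> and to a
    competing solution.\<close>
  have doubling_unique: "H x z = F x z"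
    if dbl: "\<And>x z. H (x + x) z = scaleY 2 (H x z)"
      and bound: "\<And>x. normY (f x z - H x z) \<le> e x"
      and lim: "(\<lambda>n. 1 / 2 powr (real n * \<beta>) * e (scaleX (2 ^ n) x)) \<longlonglongrightarrow> 0"
    for H e x z
  proof -
    have "H x z - F x z = 0"
    proof (rule Y.eq_0_by_scaling[where c = 2])
      fix n
      let ?x = "scaleX (2 ^ n) x"
      have "scaleY (complex_of_real 2 ^ n) (H x z - F x z) = (f ?x z - F ?x z) - (f ?x z - H ?x z)"
        using double_power[of H, OF dbl] double_power[of F, OF aq_double[OF F_aq F_0_left]]
        by (simp add: Y.scale_right_diff_distrib)
      then show "normY (scaleY (complex_of_real 2 ^ n) (H x z - F x z))
          \<le> \<Psi> ?x ?x * \<phi> z 0 + e ?x"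
        using Y.N_diff_le[of "f ?x z - F ?x z" "f ?x z - H ?x z"] F_bound[of ?x z] bound[of ?x]
        by simp
    next
      show "(\<lambda>n. 1 / 2 powr (real n * \<beta>) *
          (\<Psi> (scaleX (2 ^ n) x) (scaleX (2 ^ n) x) * \<phi> z 0 + e (scaleX (2 ^ n) x))) \<longlonglongrightarrow> 0"
        using tendsto_add[OF tendsto_mult_left_zero[OF \<Psi>_lim[of x x], of "\<phi> z 0"] lim]
        by (simp only: distrib_left mult.assoc add_0)
    qed simp
    then show ?thesis by simp
  qed

  have G_eq_F: "G x z = F x z" for x z
  proof (rule doubling_unique[of G, OF G_double G_bound])
    show "(\<lambda>n. 1 / 2 powr (real n * \<beta>) * (\<phi> (scaleX (2 ^ n) x) 0 * \<Phi> z z)) \<longlonglongrightarrow> 0"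
      using tendsto_mult_left_zero[OF \<psi>_lim2[of x 0], of "\<Phi> z z"] by (simp add: \<psi>_def)
  qed

  \<comment> \<open>Existence and uniqueness\<close>
  show ?thesis
  proof (intro ex1I[of _ F] conjI allI)
    show "normY (f x z - F x z) \<le> min (\<Psi> x x * \<phi> z 0) (\<phi> x 0 * \<Phi> z z)" for x z
      using F_bound[of x z] G_bound[of x z] by (simp add: G_eq_F)
  next
    fix H
    assume H: "additive_quadratic scaleY H \<and>
      (\<forall>x z. normY (f x z - H x z) \<le> min (\<Psi> x x * \<phi> z 0) (\<phi> x 0 * \<Phi> z z))"
    then have H_aq: "additive_quadratic scaleY H" by blast
    have H_bound: "normY (f x z - H x z) \<le> \<Psi> x x * \<phi> z 0" for x z
      using H by simp
    \<comment> \<open>The functional equation alone only makes \<open>H 0\<close> quadratic; its vanishing needs the estimate.\<close>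
    have H_0_left: "H 0 z = 0" for z
    proof (rule Y.eq_0_by_scaling[where c = 4])
      fix n
      \<comment> \<open>As \<open>f\<close> vanishes at first argument 0, the estimate bounds
        \<open>H 0\<close> itself at the dilates of \<open>z\<close> by
        \<open>\<Psi> 0 0 * \<psi> z 0 n\<close>, too small for exact growth by \<open>4 ^ n\<close>
        unless \<open>H 0 z = 0\<close>.\<close>
      have "H 0 (scaleX (2 ^ n) z) = scaleY (4 ^ n) (H 0 z)"
        by (induction n) (simp_all add: aq_quad_left_0[OF H_aq] X_Suc del: power_Suc, simp)
      then show "normY (scaleY (complex_of_real 4 ^ n) (H 0 z)) \<le> \<Psi> 0 0 * \<psi> z 0 n"
        using H_bound[of 0 "scaleX (2 ^ n) z"] by (simp add: f_0_left Y.N_minus \<psi>_def)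
    next
      show "(\<lambda>n. 1 / 4 powr (real n * \<beta>) * (\<Psi> 0 0 * \<psi> z 0 n)) \<longlonglongrightarrow> 0"
        using tendsto_mult_right_zero[OF \<psi>_lim4[of z 0], of "\<Psi> 0 0"] by (simp only: mult.left_commute)
    qed simp
    show "H = F"
    proof (intro ext doubling_unique[of H, OF aq_double[OF H_aq H_0_left] H_bound])
      fix x z
      show "(\<lambda>n. 1 / 2 powr (real n * \<beta>) *
          (\<Psi> (scaleX (2 ^ n) x) (scaleX (2 ^ n) x) * \<phi> z 0)) \<longlonglongrightarrow> 0"
        using tendsto_mult_left_zero[OF \<Psi>_lim[of x x], of "\<phi> z 0"] by (simp only: mult.assoc)
    qed
  qed (rule F_aq)
qed

end
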